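(* Let $\mathcal{F}=\{A_1,\dots,A_m\}$ be a family of $m$ distinct subsets of $[n]$ such that $|A_i|=k$ for all $i$. Suppose there exist $\ell_1,\ell_2\ge 0$ such that for all $i\ne j$: if $|i-j|=1$ then $|A_i\cap A_j|=\ell_1$, and if $|i-j|\ge 2$ then $|A_i\cap A_j|=\ell_2$. Then $m\le n$.
   Context: $[n]=\{1,\dots,n\}$. The sets in the family are indexed by $1,\dots,m$, and the intersection condition depends on the index difference $|i-j|$. *)

theory Defs
  imports Main
begin

end

theory Submission
  imports Defs
begin

text \<open>
  Suppose \<open>n < m\<close>. Then the indicator vectors of the sets satisfy a nontrivial integer relation \<open>x\<close>.
  Pairing it with the all-ones vector gives \<open>\<Sum>i. x i = 0\<close>, because all sets have the same size;
  pairing it with \<open>A j\<close> then gives \<open>a * x j + b * (x (j - 1) + x (j + 1)) = 0\<close>, where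
  \<open>a = k - l2 > 0\<close>, \<open>b = l1 - l2\<close>, and \<open>x\<close> vanishes at \<open>0\<close> and \<open>m + 1\<close>. Comparing greatest common
  divisors shows that \<open>b\<close> divides \<open>a\<close>, and a growth argument shows \<open>\<bar>a\<bar> < 2 * \<bar>b\<bar>\<close>. Hence
  \<open>\<bar>a\<bar> = \<bar>b\<bar>\<close>, and as \<open>l1 < k\<close> this forces \<open>b = - a\<close>, that is, \<open>k + l1 = 2 * l2\<close>. In that case
  \<open>x (j + 3) = - x j\<close>, so 3 divides \<open>m + 1\<close>; inclusion-exclusion gives
  \<open>card (A 1 \<union> A 2 \<union> A 3) \<ge> 5 * a\<close>, so \<open>m > 5\<close>; and \<open>m < 7\<close>, because otherwise the combination of the
  indicator vectors of \<open>A 1, \<dots>, A 7\<close> with coefficients (1,1,1,0,-1,-1,-1) would have squared norm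
  \<open>- 2 * a\<close>.
\<close>

section \<open>Underdetermined homogeneous systems\<close>

lemma sum_fraction_free_elimination:
  fixes c d x :: "'i \<Rightarrow> 'a::comm_ring"
  assumes "finite I" "p \<in> I"
  shows "(\<Sum>i\<in>I. d i * (if i = p then - (\<Sum>j\<in>I - {p}. c j * x j) else c p * x i))
    = (\<Sum>i\<in>I - {p}. (c p * d i - d p * c i) * x i)"
proof -
  have "(\<Sum>i\<in>I - {p}. d i * (if i = p then - (\<Sum>j\<in>I - {p}. c j * x j) else c p * x i))
      = (\<Sum>i\<in>I - {p}. c p * d i * x i)"
    by (intro sum.cong) (auto simp: ac_simps)
  then show ?thesis
    using assms
    by (simp add: sum.remove left_diff_distrib sum_subtractf sum_distrib_left mult.assoc)
qed

lemma homogeneous_system_nontrivial_solution: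
  fixes c :: "'e \<Rightarrow> 'i \<Rightarrow> 'a::idom"
  assumes "finite J" "card J < card I"
  shows "\<exists>x. (\<exists>i\<in>I. x i \<noteq> 0) \<and> (\<forall>j\<in>J. (\<Sum>i\<in>I. c j i * x i) = 0)"
  using assms
proof (induction J arbitrary: I c rule: finite_induct)
  case empty
  then have "I \<noteq> {}" by auto
  then show ?case by (intro exI[of _ "\<lambda>_. 1"]) auto
next
  case (insert j J)
  have "finite I" using insert.prems by (metis card.infinite not_less_zero)
  show ?case
  proof (cases "\<forall>i\<in>I. c j i = 0")
    case True
    have "card J < card I" using insert by simp
    from insert.IH[OF this] obtain x
      where "\<exists>i\<in>I. x i \<noteq> 0" "\<forall>j\<in>J. (\<Sum>i\<in>I. c j i * x i) = 0" by blast
    with True show ?thesis by (intro exI[of _ x]) auto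
  next
    case False
    then obtain p where p: "p \<in> I" "c j p \<noteq> 0" by blast
    have "card J < card (I - {p})" using insert p \<open>finite I\<close> by simp
    from insert.IH[OF this, of "\<lambda>j' i. c j p * c j' i - c j' p * c j i"] obtain x
      where nonzero: "\<exists>i\<in>I - {p}. x i \<noteq> 0"
        and solution: "\<forall>j'\<in>J. (\<Sum>i\<in>I - {p}. (c j p * c j' i - c j' p * c j i) * x i) = 0"
      by blast
    define y where "y i = (if i = p then - (\<Sum>i\<in>I - {p}. c j i * x i) else c j p * x i)" for i
    have "(\<Sum>i\<in>I. c j' i * y i) = (\<Sum>i\<in>I - {p}. (c j p * c j' i - c j' p * c j i) * x i)" for j'
      unfolding y_def using \<open>finite I\<close> p(1) by (rule sum_fraction_free_elimination)
    then have "\<forall>j'\<in>insert j J. (\<Sum>i\<in>I. c j' i * y i) = 0"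
      using solution by simp
    moreover have "\<exists>i\<in>I. y i \<noteq> 0" using nonzero p by (auto simp: y_def)
    ultimately show ?thesis by blast
  qed
qed

section \<open>Gram matrices of set systems\<close>

lemma sum_mult_card_Int:
  fixes x :: "'i \<Rightarrow> 'a::comm_semiring_1"
  assumes "finite B"
  shows "(\<Sum>i\<in>I. x i * of_nat (card (A i \<inter> B))) = (\<Sum>t\<in>B. \<Sum>i\<in>I. of_bool (t \<in> A i) * x i)"
proof -
  have "x i * of_nat (card (A i \<inter> B)) = (\<Sum>t\<in>B. of_bool (t \<in> A i) * x i)" for i
  proof -
    have "of_nat (card (A i \<inter> B)) = (\<Sum>t\<in>B. of_bool (t \<in> A i) :: 'a)"
      using assms by (simp add: Int_commute)
    then show ?thesis unfolding sum_distrib_right[symmetric] by (simp only: mult.commute)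
  qed
  then show ?thesis by (simp only: sum.swap[of _ B I])
qed

lemma set_system_nontrivial_relation:
  fixes A :: "'i \<Rightarrow> 'p set"
  assumes "finite X" "card X < card I"
  obtains x :: "'i \<Rightarrow> 'a::idom" and p where "x p \<noteq> 0" "\<And>i. i \<notin> I \<Longrightarrow> x i = 0"
    and "\<And>B. B \<subseteq> X \<Longrightarrow> (\<Sum>i\<in>I. x i * of_nat (card (A i \<inter> B))) = 0"
proof -
  obtain y :: "'i \<Rightarrow> 'a" and p where p: "p \<in> I" "y p \<noteq> 0"
    and pointwise: "\<And>t. t \<in> X \<Longrightarrow> (\<Sum>i\<in>I. of_bool (t \<in> A i) * y i) = 0"
    using homogeneous_system_nontrivial_solution[OF assms, of "\<lambda>t i. of_bool (t \<in> A i)"] by blast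
  define x where "x i = (if i \<in> I then y i else 0)" for i
  show thesis
  proof (rule that[of x p])
    fix B assume "B \<subseteq> X"
    with assms(1) have "finite B" by (rule finite_subset[rotated])
    have "(\<Sum>i\<in>I. x i * of_nat (card (A i \<inter> B))) = (\<Sum>i\<in>I. y i * of_nat (card (A i \<inter> B)))"
      by (intro sum.cong) (simp_all add: x_def)
    also have "\<dots> = (\<Sum>t\<in>B. \<Sum>i\<in>I. of_bool (t \<in> A i) * y i)"
      using \<open>finite B\<close> by (rule sum_mult_card_Int)
    also have "\<dots> = 0"
      using \<open>B \<subseteq> X\<close> pointwise by (intro sum.neutral) blast
    finally show "(\<Sum>i\<in>I. x i * of_nat (card (A i \<inter> B))) = 0" .
  qed (use p in \<open>simp_all add: x_def\<close>)
qed

lemma Gram_quadratic_form_nonneg: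
  fixes x :: "'i \<Rightarrow> 'a::linordered_idom"
  assumes "finite I" "\<And>i. i \<in> I \<Longrightarrow> finite (A i)"
  shows "0 \<le> (\<Sum>j\<in>I. x j * (\<Sum>i\<in>I. x i * of_nat (card (A i \<inter> A j))))"
proof -
  define f where "f t = (\<Sum>i\<in>I. of_bool (t \<in> A i) * x i)" for t
  define U where "U = (\<Union>i\<in>I. A i)"
  have "finite U" using assms by (simp add: U_def)
  have "(\<Sum>j\<in>I. x j * (\<Sum>i\<in>I. x i * of_nat (card (A i \<inter> A j))))
      = (\<Sum>j\<in>I. x j * (\<Sum>t\<in>A j. f t))"
    unfolding f_def using assms(2) by (intro sum.cong refl arg_cong2[of _ _ _ _ "(*)"] sum_mult_card_Int)
  also have "\<dots> = (\<Sum>j\<in>I. \<Sum>t\<in>U. of_bool (t \<in> A j) * x j * f t)"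
  proof (intro sum.cong refl)
    fix j assume "j \<in> I"
    then have "U \<inter> {t. t \<in> A j} = A j" by (auto simp: U_def)
    then show "x j * (\<Sum>t\<in>A j. f t) = (\<Sum>t\<in>U. of_bool (t \<in> A j) * x j * f t)"
      using \<open>finite U\<close> by (simp add: sum_distrib_left mult.assoc)
  qed
  also have "\<dots> = (\<Sum>t\<in>U. f t * f t)"
    by (subst sum.swap) (simp only: f_def sum_distrib_right)
  finally show ?thesis by (simp add: sum_nonneg)
qed

section \<open>Cardinalities of intersections and unions\<close>

lemma card_Int_less_if_distinct:
  assumes "finite A" "finite B" "card A = card B" "A \<noteq> B"
  shows "card (A \<inter> B) < card A"
proof -
  have "A \<inter> B \<noteq> A" using assms card_subset_eq[of B A] by auto
  then have "A \<inter> B \<subset> A" by blast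
  then show ?thesis using assms(1) by (rule psubset_card_mono[rotated])
qed

lemma card_Un3_Bonferroni:
  assumes "finite A" "finite B" "finite C"
  shows "card A + card B + card C
    \<le> card (A \<union> B \<union> C) + card (A \<inter> B) + card (A \<inter> C) + card (B \<inter> C)"
proof -
  have "card (A \<union> B) + card C = card (A \<union> B \<union> C) + card ((A \<union> B) \<inter> C)"
    using assms by (intro card_Un_Int) auto
  moreover have "card ((A \<union> B) \<inter> C) \<le> card (A \<inter> C) + card (B \<inter> C)"
    unfolding Int_Un_distrib2 by (rule card_Un_le)
  ultimately show ?thesis
    using card_Un_Int[OF assms(1,2)] by linarith
qed

section \<open>Tridiagonal Toeplitz matrices\<close>

text \<open>
  The kernel of \<open>a I + b P\<close>, where \<open>P\<close> is the adjacency matrix of the path \<open>1, \<dots>, m\<close>; vectors are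
  extended by zero outside \<open>{1..m}\<close>.
\<close>
definition path_kernel :: "nat \<Rightarrow> 'a::comm_ring \<Rightarrow> 'a \<Rightarrow> (nat \<Rightarrow> 'a) set" where
  "path_kernel m a b = {x. (\<forall>i. i \<notin> {1..m} \<longrightarrow> x i = 0) \<and>
     (\<forall>i<m. a * x (Suc i) + b * (x i + x (Suc (Suc i))) = 0)}"

lemma path_kernel_eq_0: "x \<in> path_kernel m a b \<Longrightarrow> i \<notin> {1..m} \<Longrightarrow> x i = 0"
  by (simp add: path_kernel_def)

lemma path_kernel_support: "x \<in> path_kernel m a b \<Longrightarrow> x p \<noteq> 0 \<Longrightarrow> p \<in> {1..m}"
  using path_kernel_eq_0 by blast

lemma path_kernel_recurrence:
  "x \<in> path_kernel m a b \<Longrightarrow> i < m \<Longrightarrow> a * x (Suc i) = - (b * (x i + x (Suc (Suc i))))"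
  by (simp add: path_kernel_def eq_neg_iff_add_eq_0)

lemma path_kernel_dvd:
  fixes a b :: "'a::{ring_gcd, semiring_Gcd}"
  assumes x: "x \<in> path_kernel m a b" and nonzero: "x p \<noteq> 0"
  shows "b dvd a"
proof -
  define g where "g = Gcd (range x)"
  have "g \<noteq> 0" using nonzero by (auto simp: g_def)
  have g_dvd: "g dvd x i" for i unfolding g_def by (rule Gcd_dvd) (rule rangeI)
  have "b * g dvd a * x i" for i
  proof (cases "i \<in> {1..m}")
    case True
    then obtain j where "i = Suc j" "j < m" by (cases i) auto
    moreover have "b * g dvd b * (x j + x (Suc (Suc j)))"
      using g_dvd by (intro mult_dvd_mono dvd_add) auto
    ultimately show ?thesis using path_kernel_recurrence[OF x, of j] by simp
  qed (simp add: path_kernel_eq_0[OF x])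
  then have "b * g dvd Gcd ((*) a ` range x)" by (intro Gcd_greatest) auto
  then have "b * g dvd a * g" by (simp add: Gcd_mult g_def)
  with \<open>g \<noteq> 0\<close> show ?thesis by simp
qed

lemma path_kernel_abs_less:
  fixes a b :: "'a::linordered_idom"
  assumes x: "x \<in> path_kernel m a b" and nonzero: "x p \<noteq> 0" and "a \<noteq> 0"
  shows "\<bar>a\<bar> < 2 * \<bar>b\<bar>"
proof (rule ccontr)
  assume "\<not> \<bar>a\<bar> < 2 * \<bar>b\<bar>"
  then have b_le: "2 * \<bar>b\<bar> \<le> \<bar>a\<bar>" by simp
  have growth: "\<bar>x i\<bar> \<le> \<bar>x (Suc i)\<bar>" if "i \<le> m" for i
    using that
  proof (induction i)
    case (Suc i)
    define s where "s = x i + x (Suc (Suc i))"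
    have "\<bar>a\<bar> * (2 * \<bar>x (Suc i)\<bar>) = 2 * \<bar>b\<bar> * \<bar>s\<bar>"
      using path_kernel_recurrence[OF x, of i] Suc.prems by (simp add: s_def flip: abs_mult)
    also have "\<dots> \<le> \<bar>a\<bar> * \<bar>s\<bar>" using b_le by (intro mult_right_mono) auto
    finally have "2 * \<bar>x (Suc i)\<bar> \<le> \<bar>s\<bar>" using \<open>a \<noteq> 0\<close> by simp
    moreover have "\<bar>x i\<bar> \<le> \<bar>x (Suc i)\<bar>" using Suc by simp
    ultimately show ?case unfolding s_def by linarith
  qed (simp add: path_kernel_eq_0[OF x])
  have "p \<le> Suc m" using path_kernel_support[OF x nonzero] by simp
  then have "\<bar>x p\<bar> \<le> \<bar>x (Suc m)\<bar>"
  proof (induction rule: inc_induct)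
    case (step i)
    then show ?case using growth[of i] by simp
  qed simp
  with nonzero show False by (simp add: path_kernel_eq_0[OF x])
qed

lemma int_path_kernel_abs_eq:
  fixes a b :: int
  assumes "x \<in> path_kernel m a b" "x p \<noteq> 0" "a \<noteq> 0"
  shows "\<bar>a\<bar> = \<bar>b\<bar>"
proof -
  obtain q where q: "a = b * q" using path_kernel_dvd[OF assms(1,2)] by blast
  have "\<bar>b\<bar> * \<bar>q\<bar> < \<bar>b\<bar> * 2"
    using path_kernel_abs_less[OF assms] by (simp add: q abs_mult)
  then have "\<bar>q\<bar> < 2" by (simp add: mult_less_cancel_left)
  moreover have "q \<noteq> 0" using assms(3) q by auto
  ultimately have "\<bar>q\<bar> = 1" by linarith
  then show ?thesis by (simp add: q abs_mult)
qed

lemma path_kernel_1_nonzero: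
  fixes a b :: "'a::idom"
  assumes x: "x \<in> path_kernel m a b" and nonzero: "x p \<noteq> 0" and "b \<noteq> 0"
  shows "x 1 \<noteq> 0"
proof
  assume "x 1 = 0"
  have "x i = 0" if "i \<le> Suc m" for i
    using that
  proof (induction i rule: induct_nat_012)
    case (ge2 i)
    then show ?case using path_kernel_recurrence[OF x, of i] \<open>b \<noteq> 0\<close> by simp
  qed (use \<open>x 1 = 0\<close> path_kernel_eq_0[OF x, of 0] in simp_all)
  with nonzero path_kernel_support[OF x nonzero] show False by simp
qed

lemma path_kernel_opposite_3_dvd:
  fixes a :: "'a::idom"
  assumes x: "x \<in> path_kernel m a (- a)" and nonzero: "x p \<noteq> 0" and "a \<noteq> 0"
  shows "3 dvd Suc m"
proof -
  have recurrence: "x (Suc (Suc i)) = x (Suc i) - x i" if "i < m" for i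
  proof -
    have "a * x (Suc i) = a * (x i + x (Suc (Suc i)))"
      using path_kernel_recurrence[OF x that] by simp
    with \<open>a \<noteq> 0\<close> show ?thesis by simp
  qed
  have antiperiod: "x (i + 3) = - x i" if "Suc i < m" for i
    using recurrence[of i] recurrence[of "Suc i"] that by (simp add: numeral_3_eq_3)
  have "x 1 \<noteq> 0" using path_kernel_1_nonzero[OF x nonzero] \<open>a \<noteq> 0\<close> by simp
  have "x 0 = 0" by (simp add: path_kernel_eq_0[OF x])
  have "x i = 0 \<longleftrightarrow> 3 dvd i" if "i \<le> Suc m" for i
    using that
  proof (induction i rule: less_induct)
    case (less i)
    consider (zero) "i = 0" | (one) "i = 1" | (two) "i = 2" | (step) "3 \<le> i" by linarith
    then show ?case
    proof cases
      case two
      then have "x i = x 1"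
        using recurrence[of 0] less.prems \<open>x 0 = 0\<close> by (simp add: numeral_2_eq_2)
      with two \<open>x 1 \<noteq> 0\<close> show ?thesis by simp
    next
      case step
      then obtain j where "i = j + 3" by (metis add.commute le_Suc_ex)
      then show ?thesis using less.IH[of j] less.prems antiperiod[of j] by simp
    qed (use \<open>x 0 = 0\<close> \<open>x 1 \<noteq> 0\<close> in simp_all)
  qed
  then show ?thesis using path_kernel_eq_0[OF x, of "Suc m"] by simp
qed

section \<open>Path-intersecting families\<close>

locale path_intersecting_family =
  fixes X :: "'a set" and A :: "nat \<Rightarrow> 'a set" and m k l1 l2 :: nat
  assumes finite_ground: "finite X"
    and subset_ground: "i \<in> {1..m} \<Longrightarrow> A i \<subseteq> X"
    and distinct: "inj_on A {1..m}"
    and uniform: "i \<in> {1..m} \<Longrightarrow> card (A i) = k"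
    and card_Int_consecutive: "1 \<le> i \<Longrightarrow> i < m \<Longrightarrow> card (A i \<inter> A (Suc i)) = l1"
    and card_Int_far: "1 \<le> i \<Longrightarrow> i + 2 \<le> j \<Longrightarrow> j \<le> m \<Longrightarrow> card (A i \<inter> A j) = l2"
begin

lemma finite_member: "i \<in> {1..m} \<Longrightarrow> finite (A i)"
  using subset_ground finite_ground finite_subset by blast

lemma card_Int_less:
  assumes "i \<in> {1..m}" "j \<in> {1..m}" "i \<noteq> j"
  shows "card (A i \<inter> A j) < k"
proof -
  have "A i \<noteq> A j" using assms inj_onD[OF distinct] by blast
  with assms have "card (A i \<inter> A j) < card (A i)"
    by (intro card_Int_less_if_distinct) (simp_all add: finite_member uniform)
  with assms show ?thesis by (simp add: uniform)
qed

lemma l1_less: "2 \<le> m \<Longrightarrow> l1 < k"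
  using card_Int_less[of 1 2] card_Int_consecutive[of 1] by (simp add: numeral_2_eq_2)

lemma l2_less: "3 \<le> m \<Longrightarrow> l2 < k"
  using card_Int_less[of 1 3] card_Int_far[of 1 3] by simp

lemma card_Int_eq:
  assumes "i \<in> {1..m}" "j \<in> {1..m}"
  shows "int (card (A i \<inter> A j)) = int l2 + (int k - int l2) * of_bool (i = j)
    + (int l1 - int l2) * (of_bool (Suc i = j) + of_bool (i = Suc j))"
proof -
  consider "i = j" | "Suc i = j" | "i = Suc j" | "i + 2 \<le> j" | "j + 2 \<le> i" by linarith
  then show ?thesis
    using assms card_Int_consecutive[of i] card_Int_consecutive[of j]
      card_Int_far[of i j] card_Int_far[of j i]
    by cases (auto simp: uniform Int_commute)
qed

lemma sum_mult_card_Int_member: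
  assumes zero: "\<And>i. i \<notin> {1..m} \<Longrightarrow> x i = 0" and "j < m"
  shows "(\<Sum>i\<in>{1..m}. x i * int (card (A i \<inter> A (Suc j)))) = int l2 * (\<Sum>i\<in>{1..m}. x i)
    + ((int k - int l2) * x (Suc j) + (int l1 - int l2) * (x j + x (Suc (Suc j))))"
proof -
  have single_term: "(\<Sum>i\<in>{1..m}. x i * of_bool (i = r)) = x r" for r
    using zero[of r] by (cases "r \<in> {1..m}") (auto simp: Int_insert_right simp del: atLeastAtMost_iff)
  have "(\<Sum>i\<in>{1..m}. x i * int (card (A i \<inter> A (Suc j))))
      = (\<Sum>i\<in>{1..m}. int l2 * x i + ((int k - int l2) * (x i * of_bool (i = Suc j))
        + (int l1 - int l2) * (x i * of_bool (i = j) + x i * of_bool (i = Suc (Suc j)))))"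
    using \<open>j < m\<close> by (intro sum.cong refl) (simp add: card_Int_eq algebra_simps)
  then show ?thesis
    by (simp only: sum.distrib sum_distrib_left[symmetric] single_term)
qed

lemma exists_path_kernel_vector:
  assumes "card X < m" "0 < k"
  obtains x p where "x \<in> path_kernel m (int k - int l2) (int l1 - int l2)" "x p \<noteq> 0"
proof -
  have enough_sets: "card X < card {1..m}" using assms(1) by simp
  obtain x :: "nat \<Rightarrow> int" and p where "x p \<noteq> 0" and zero: "\<And>i. i \<notin> {1..m} \<Longrightarrow> x i = 0"
    and orthogonal: "\<And>B. B \<subseteq> X \<Longrightarrow> (\<Sum>i\<in>{1..m}. x i * int (card (A i \<inter> B))) = 0"
    by (rule set_system_nontrivial_relation[OF finite_ground enough_sets, where A = A]) (rule that)
  have "(\<Sum>i\<in>{1..m}. x i) * int k = (\<Sum>i\<in>{1..m}. x i * int (card (A i \<inter> X)))"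
    unfolding sum_distrib_right
    by (intro sum.cong) (simp_all add: Int_absorb2[OF subset_ground] uniform)
  then have sum_zero: "(\<Sum>i\<in>{1..m}. x i) = 0"
    using orthogonal[of X] assms(2) by simp
  have "(int k - int l2) * x (Suc j) + (int l1 - int l2) * (x j + x (Suc (Suc j))) = 0"
    if "j < m" for j
  proof -
    have "A (Suc j) \<subseteq> X" using that by (intro subset_ground) simp
    from orthogonal[OF this] show ?thesis
      using sum_mult_card_Int_member[where x = x, OF zero that]
      by (simp add: sum_zero del: One_nat_def)
  qed
  with zero have "x \<in> path_kernel m (int k - int l2) (int l1 - int l2)"
    unfolding path_kernel_def by blast
  then show thesis using \<open>x p \<noteq> 0\<close> by (rule that)
qed

lemma two_le_card_ground:
  assumes "2 \<le> m"
  shows "2 \<le> card X"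
proof -
  have "card (A 1 \<inter> A 2) < k" "card (A 1) = k" "card (A 2) = k"
    using assms by (simp_all add: card_Int_less uniform)
  moreover have "card (A 1) + card (A 2) = card (A 1 \<union> A 2) + card (A 1 \<inter> A 2)"
    using assms by (intro card_Un_Int) (simp_all add: finite_member)
  moreover have "card (A 1 \<union> A 2) \<le> card X"
    using assms subset_ground by (intro card_mono finite_ground) auto
  ultimately show ?thesis by linarith
qed

lemma five_le_card_ground:
  assumes "3 \<le> m" and balanced: "k + l1 = 2 * l2"
  shows "5 \<le> card X"
proof -
  have "card (A 1) + card (A 2) + card (A 3) \<le> card (A 1 \<union> A 2 \<union> A 3)
      + card (A 1 \<inter> A 2) + card (A 1 \<inter> A 3) + card (A 2 \<inter> A 3)"
    using assms(1) by (intro card_Un3_Bonferroni) (simp_all add: finite_member)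
  moreover have "card (A 1 \<inter> A 2) = l1" "card (A 2 \<inter> A 3) = l1" "card (A 1 \<inter> A 3) = l2"
    using assms(1) card_Int_consecutive[of 1] card_Int_consecutive[of 2] card_Int_far[of 1 3]
    by (simp_all flip: numeral_2_eq_2)
  moreover have "card (A 1) = k" "card (A 2) = k" "card (A 3) = k"
    using assms(1) by (simp_all add: uniform)
  moreover have "card (A 1 \<union> A 2 \<union> A 3) \<le> card X"
    using assms(1) subset_ground by (intro card_mono finite_ground) auto
  ultimately show ?thesis using l2_less[OF assms(1)] balanced by linarith
qed

lemma size_less_7_if_balanced:
  assumes balanced: "k + l1 = 2 * l2"
  shows "m < 7"
proof (rule ccontr)
  assume "\<not> m < 7"
  then have "7 \<le> m" by simp
  define y :: "nat \<Rightarrow> int" where "y i = (if i < 4 then 1 else - 1)" for i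
  have l1_eq: "int l1 = 2 * int l2 - int k" using balanced by simp
  have "0 \<le> (\<Sum>j\<in>{1,2,3,5,6,7}. y j * (\<Sum>i\<in>{1,2,3,5,6,7}. y i * int (card (A i \<inter> A j))))"
    using \<open>7 \<le> m\<close> by (intro Gram_quadratic_form_nonneg) (auto intro: finite_member)
  also have "\<dots> = - 2 * (int k - int l2)"
    using \<open>7 \<le> m\<close> by (simp add: y_def uniform card_Int_eq l1_eq)
  finally show False using l2_less \<open>7 \<le> m\<close> by simp
qed

theorem size_le_card_ground:
  assumes "X \<noteq> {}"
  shows "m \<le> card X"
proof (rule ccontr)
  assume "\<not> m \<le> card X"
  then have card_less: "card X < m" by simp
  moreover have "0 < card X" using assms finite_ground by (simp add: card_gt_0_iff)
  ultimately have "3 \<le> m" using two_le_card_ground by linarith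
  then have l_less: "l1 < k" "l2 < k" by (simp_all add: l1_less l2_less)
  then obtain x p where x: "x \<in> path_kernel m (int k - int l2) (int l1 - int l2)" "x p \<noteq> 0"
    using exists_path_kernel_vector[OF card_less] by auto
  have "\<bar>int k - int l2\<bar> = \<bar>int l1 - int l2\<bar>"
    using l_less by (intro int_path_kernel_abs_eq[OF x]) simp
  then have balanced: "k + l1 = 2 * l2" using l_less by linarith
  then have "int l1 - int l2 = - (int k - int l2)" by simp
  then have "3 dvd Suc m"
    using path_kernel_opposite_3_dvd[of x m "int k - int l2" p] x l_less by simp
  moreover have "5 < m" using five_le_card_ground[OF \<open>3 \<le> m\<close> balanced] card_less by simp
  moreover have "m < 7" using size_less_7_if_balanced[OF balanced] .
  ultimately show False by presburger
qed

end

theorem theorem1p7: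
  fixes n m k :: nat and A :: "nat \<Rightarrow> nat set"
  assumes "n \<ge> 1"
    and "\<forall>i\<in>{1..m}. A i \<subseteq> {1..n}"
    and "inj_on A {1..m}"
    and "\<forall>i\<in>{1..m}. card (A i) = k"
    and "\<exists>l1 l2 :: nat. \<forall>i\<in>{1..m}. \<forall>j\<in>{1..m}. i \<noteq> j \<longrightarrow>
           (\<bar>int i - int j\<bar> = 1 \<longrightarrow> card (A i \<inter> A j) = l1) \<and>
           (\<bar>int i - int j\<bar> \<ge> 2 \<longrightarrow> card (A i \<inter> A j) = l2)"
  shows "m \<le> n"
proof -
  obtain l1 l2 where card_Int: "\<forall>i\<in>{1..m}. \<forall>j\<in>{1..m}. i \<noteq> j \<longrightarrow>
      (\<bar>int i - int j\<bar> = 1 \<longrightarrow> card (A i \<inter> A j) = l1) \<and>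
      (\<bar>int i - int j\<bar> \<ge> 2 \<longrightarrow> card (A i \<inter> A j) = l2)"
    using assms(5) by blast
  interpret path_intersecting_family "{1..n}" A m k l1 l2
    using assms(2-4) card_Int by unfold_locales auto
  show ?thesis using size_le_card_ground assms(1) by simp
qed

end
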